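(* Let $d\ge2$, let $\mathcal{A}\in\mathbb{R}^{n_1\times\cdots\times n_d}$, and let $\tilde{\mathcal{A}}$ be the sum of any nonempty subcollection $I$ of the terms of a TTr1 decomposition of $\mathcal{A}$ (as produced by the TTr1SVD procedure described in the context); that is, $\tilde{\mathcal{A}}=\sum_{i\in I}\tilde\sigma_i\, a^{(1)}_i\circ a^{(2)}_i\circ\cdots\circ a^{(d)}_i$, where $a^{(k)}_i\in\mathbb{R}^{n_k}$ is the mode-$k$ vector of the $i$th term. For each $k=1,\dots,d$ let $r_k$ be the rank of the matrix whose columns are the vectors $a^{(k)}_i$, $i\in I$. Then $\tilde{\mathcal{A}}$ can be written in Tucker form $$\tilde{\mathcal{A}}=\mathcal{S}\times_1U_1\times_2U_2\cdots\times_dU_d$$ with a core tensor $\mathcal{S}\in\mathbb{R}^{r_1\times r_2\times\cdots\times r_d}$ and factor matrices $U_k\in\mathbb{R}^{n_k\times r_k}$ having orthonormal columns.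
   Context: The $k$-mode product of a tensor $\mathcal{S}\in\mathbb{R}^{m_1\times\cdots\times m_d}$ with a matrix $U\in\mathbb{R}^{p\times m_k}$ is $(\mathcal{S}\times_kU)_{i_1\cdots i_{k-1}ji_{k+1}\cdots i_d}=\sum_{i_k=1}^{m_k}U_{ji_k}\mathcal{S}_{i_1\cdots i_k\cdots i_d}$. The outer product $a^{(1)}\circ\cdots\circ a^{(d)}$ of vectors is the tensor with entries $a^{(1)}_{i_1}\cdots a^{(d)}_{i_d}$. TTr1SVD procedure. Let $\rho_k=\min\left(n_{k+1},\prod_{i=k+2}^{d}n_i\right)$ for $0\le k\le d-2$. Level 0: reshape $\mathcal{A}$ into the $n_1\times\prod_{i=2}^d n_i$ matrix $\bar{\mathcal{A}}$ with rows indexed by $i_1$ and columns by $(i_2,\dots,i_d)$. Take an economical SVD $\bar{\mathcal{A}}=\sum_{j=1}^{\rho_0}\sigma_j u_j v_j^T$, with $\sigma_j\ge0$, $u_1,\dots,u_{\rho_0}$ orthonormal and $v_1,\dots,v_{\rho_0}$ orthonormal. Level $k$, for $1\le k\le d-2$: for each node $(j_1,\dots,j_k)$ with $1\le j_{s+1}\le\rho_s$, reshape the unit vector $v_{j_1\cdots j_k}$, indexed by $(i_{k+1},\dots,i_d)$, into the $n_{k+1}\times\prod_{i=k+2}^d n_i$ matrix $\bar v_{j_1\cdots j_k}$ with rows indexed by $i_{k+1}$. Take an economical SVD $\bar v_{j_1\cdots j_k}=\sum_{j=1}^{\rho_k}\sigma_{j_1\cdots j_k j}\,u_{j_1\cdots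 j_k j}\,v_{j_1\cdots j_k j}^T$, again with $\sigma$'s nonnegative and the $u$'s and the $v$'s each orthonormal. The terms of the TTr1 decomposition are indexed by the leaves $(j_1,\dots,j_{d-1})$, $1\le j_{s+1}\le\rho_s$. The term at a leaf has weight $\tilde\sigma=\sigma_{j_1}\sigma_{j_1j_2}\cdots\sigma_{j_1\cdots j_{d-1}}$, mode-$k$ vector $u_{j_1\cdots j_k}$ for $k=1,\dots,d-1$, and mode-$d$ vector $v_{j_1\cdots j_{d-1}}$. The tensor $\mathcal{A}$ is the sum over all leaves of the weighted outer products of the mode vectors. *)

theory Defs
  imports "Jordan_Normal_Form.DL_Rank" "HOL-Library.FuncSet"
begin

text \<open>
  All indices (tensor entries, modes, SVD terms) start at 0, so mode \<open>k\<close> here is the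
  mathematical mode \<open>k + 1\<close> and \<open>ns ! k\<close> is \<open>n\<^sub>k\<^sub>+\<^sub>1\<close>.
\<close>

definition multi_indices :: "nat list \<Rightarrow> nat list set" where
  "multi_indices ns = {is. length is = length ns \<and> (\<forall>k<length ns. is ! k < ns ! k)}"

datatype tensor = Tensor (dims: "nat list") (entry: "nat list \<Rightarrow> real")

text \<open>
  Entries outside the index range are normalised to \<open>undefined\<close>, so that equality of elements of
  \<open>tensor_carrier ns\<close> is equality of tensors.
\<close>

definition tensor_carrier :: "nat list \<Rightarrow> tensor set" where
  "tensor_carrier ns = {T. dims T = ns \<and> entry T \<in> extensional (multi_indices ns)}"

definition mk_tensor :: "nat list \<Rightarrow> (nat list \<Rightarrow> real) \<Rightarrow> tensor" where
  "mk_tensor ns f = Tensor ns (restrict f (multi_indices ns))"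

definition tensor_inner :: "tensor \<Rightarrow> tensor \<Rightarrow> real" where
  "tensor_inner S T = (\<Sum>is\<in>multi_indices (dims S). entry S is * entry T is)"

definition mode_product :: "tensor \<Rightarrow> nat \<Rightarrow> real mat \<Rightarrow> tensor" where
  "mode_product S k U = mk_tensor ((dims S)[k := dim_row U])
     (\<lambda>is. \<Sum>i<dims S ! k. U $$ (is ! k, i) * entry S (is[k := i]))"

definition tucker_product :: "tensor \<Rightarrow> (nat \<Rightarrow> real mat) \<Rightarrow> tensor" where
  "tucker_product S U = foldl (\<lambda>T k. mode_product T k (U k)) S [0..<length (dims S)]"

definition outer_product :: "real vec list \<Rightarrow> tensor" where
  "outer_product as = mk_tensor (map dim_vec as) (\<lambda>is. \<Prod>k<length as. (as ! k) $ (is ! k))"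

definition orthonormal_vecs :: "nat \<Rightarrow> (nat \<Rightarrow> real vec) \<Rightarrow> bool" where
  "orthonormal_vecs m u \<longleftrightarrow> (\<forall>i<m. \<forall>j<m. u i \<bullet> u j = (if i = j then 1 else 0))"

definition orthonormal_tensors :: "nat \<Rightarrow> (nat \<Rightarrow> tensor) \<Rightarrow> bool" where
  "orthonormal_tensors m v \<longleftrightarrow>
     (\<forall>i<m. \<forall>j<m. tensor_inner (v i) (v j) = (if i = j then 1 else 0))"

definition orthonormal_cols :: "real mat \<Rightarrow> bool" where
  "orthonormal_cols U \<longleftrightarrow> orthonormal_vecs (dim_col U) (col U)"

text \<open>
  The reshaping of a tensor into a matrix whose rows are indexed by the first mode. Its columns are
  indexed by the multi-indices of the remaining modes, without flattening these to numbers;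
  accordingly the right singular vectors below are tensors over the remaining modes.
\<close>

definition reshape :: "tensor \<Rightarrow> nat \<Rightarrow> nat list \<Rightarrow> real" where
  "reshape T i is = entry T (i # is)"

text \<open>
  \<open>M = (\<Sum>j<\<rho>. \<sigma>\<^sub>j u\<^sub>j v\<^sub>j\<^sup>T)\<close> for a matrix \<open>M\<close> with row indices \<open>{..<n}\<close> and
  column indices \<open>multi_indices cs\<close>.
\<close>

definition economical_svd ::
  "nat \<Rightarrow> nat list \<Rightarrow> (nat \<Rightarrow> nat list \<Rightarrow> real) \<Rightarrow> nat \<Rightarrow>
   (nat \<Rightarrow> real) \<Rightarrow> (nat \<Rightarrow> real vec) \<Rightarrow> (nat \<Rightarrow> tensor) \<Rightarrow> bool" where
  "economical_svd n cs M \<rho> \<sigma> u v \<longleftrightarrow>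
     (\<forall>j<\<rho>. \<sigma> j \<ge> 0 \<and> u j \<in> carrier_vec n \<and> v j \<in> tensor_carrier cs) \<and>
     orthonormal_vecs \<rho> u \<and> orthonormal_tensors \<rho> v \<and>
     (\<forall>i<n. \<forall>is\<in>multi_indices cs. M i is = (\<Sum>j<\<rho>. \<sigma> j * u j $ i * entry (v j) is))"

definition TTr1_rho :: "nat list \<Rightarrow> nat \<Rightarrow> nat" where
  "TTr1_rho ns k = min (ns ! k) (prod_list (drop (Suc k) ns))"

definition TTr1_nodes :: "nat list \<Rightarrow> nat \<Rightarrow> nat list set" where
  "TTr1_nodes ns k = {js. length js = k \<and> (\<forall>s<k. js ! s < TTr1_rho ns s)}"

definition TTr1_leaves :: "nat list \<Rightarrow> nat list set" where
  "TTr1_leaves ns = TTr1_nodes ns (length ns - 1)"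

text \<open>
  \<open>\<sigma> js\<close>, \<open>u js\<close>, \<open>v js\<close> are the singular value and vectors attached to the node \<open>js\<close>. Since
  singular value decompositions are not unique, the procedure is a relation between \<open>A\<close> and its
  possible outputs.
\<close>

definition TTr1_decomposition ::
  "nat list \<Rightarrow> tensor \<Rightarrow> (nat list \<Rightarrow> real) \<Rightarrow> (nat list \<Rightarrow> real vec) \<Rightarrow>
   (nat list \<Rightarrow> tensor) \<Rightarrow> bool" where
  "TTr1_decomposition ns A \<sigma> u v \<longleftrightarrow>
     economical_svd (ns ! 0) (drop 1 ns) (reshape A) (TTr1_rho ns 0)
       (\<lambda>j. \<sigma> [j]) (\<lambda>j. u [j]) (\<lambda>j. v [j]) \<and>
     (\<forall>k\<in>{1..length ns - 2}. \<forall>js\<in>TTr1_nodes ns k.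
        economical_svd (ns ! k) (drop (Suc k) ns) (reshape (v js)) (TTr1_rho ns k)
          (\<lambda>j. \<sigma> (js @ [j])) (\<lambda>j. u (js @ [j])) (\<lambda>j. v (js @ [j])))"

definition TTr1_weight :: "(nat list \<Rightarrow> real) \<Rightarrow> nat list \<Rightarrow> real" where
  "TTr1_weight \<sigma> js = (\<Prod>k<length js. \<sigma> (take (Suc k) js))"

definition TTr1_mode_vec ::
  "nat list \<Rightarrow> (nat list \<Rightarrow> real vec) \<Rightarrow> (nat list \<Rightarrow> tensor) \<Rightarrow> nat \<Rightarrow> nat list \<Rightarrow> real vec" where
  "TTr1_mode_vec ns u v k js =
     (if k < length ns - 1 then u (take (Suc k) js) else vec (ns ! k) (\<lambda>i. entry (v js) [i]))"

definition TTr1_partial_sum ::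
  "nat list \<Rightarrow> (nat list \<Rightarrow> real) \<Rightarrow> (nat list \<Rightarrow> real vec) \<Rightarrow> (nat list \<Rightarrow> tensor) \<Rightarrow>
   nat list set \<Rightarrow> tensor" where
  "TTr1_partial_sum ns \<sigma> u v I = mk_tensor ns (\<lambda>is. \<Sum>js\<in>I. TTr1_weight \<sigma> js *
     entry (outer_product (map (\<lambda>k. TTr1_mode_vec ns u v k js) [0..<length ns])) is)"

end

theory Submission
  imports Defs "Jordan_Normal_Form.Gram_Schmidt"
begin

text \<open>
  A partial sum of a TTr1 decomposition is a sum of weighted outer products, and only the spans of
  its mode vectors matter. For each mode \<open>k\<close>, choose the columns of \<open>U\<^sub>k\<close> as an orthonormal
  basis of the span of the mode-\<open>k\<close> vectors; this basis has exactly \<open>r\<^sub>k\<close> elements, and every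
  mode-\<open>k\<close> vector is \<open>U\<^sub>k c\<close> for a coordinate vector \<open>c\<close> of length \<open>r\<^sub>k\<close>
  (\<open>rank_orthonormal_factor\<close>). The core tensor is the same weighted sum of outer products with
  every mode vector replaced by its coordinate vector. Since \<open>S \<times>\<^sub>k U\<close> is linear in \<open>S\<close> and
  turns an outer product into the outer product with \<open>k\<close>th factor multiplied by \<open>U\<close>
  (\<open>mode_product_cp_tensor\<close>), multiplying the core by \<open>U\<^sub>1, \<dots>, U\<^sub>d\<close> in turn restores the original
  mode vectors (\<open>tucker_product_cp_tensor\<close>). That the mode-\<open>k\<close> vectors lie in the \<open>k\<close>th factor space
  follows from the singular value decompositions at the nodes above the leaf
  (\<open>TTr1_mode_vec_carrier\<close>).
\<close>

section \<open>An orthonormal basis of a column space\<close>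

text \<open>
  A vector of \<open>W\<close> outside the span of \<open>S\<close> could be added to \<open>S\<close> without losing independence.
\<close>

lemma (in vec_space) maximal_lin_indpt_spans:
  assumes "W \<subseteq> carrier_vec n"
    and "maximal S (\<lambda>T. T \<subseteq> W \<and> lin_indpt T)"
  shows "W \<subseteq> span S"
proof
  fix w assume w: "w \<in> W"
  have S: "S \<subseteq> W" "lin_indpt S"
    using assms(2) unfolding maximal_def by auto
  show "w \<in> span S"
  proof (rule ccontr)
    assume nin: "w \<notin> span S"
    have "w \<notin> S"
      using nin S(1) assms(1) span_mem by auto
    have "lin_indpt (S \<union> {w})"
      using lin_dep_iff_in_span[of S w] S assms(1) w nin \<open>w \<notin> S\<close> by auto
    hence "S \<union> {w} = S"
      using assms(2) S(1) w unfolding maximal_def by blast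
    thus False using \<open>w \<notin> S\<close> by blast
  qed
qed

text \<open>
  A thin QR factorisation without a full-rank assumption: Gram-Schmidt is applied to a maximal
  independent set of columns of \<open>A\<close>, which has \<open>rank A\<close> elements, and its output is normalised.
\<close>

lemma rank_orthonormal_factor:
  fixes A :: "real mat"
  assumes A: "A \<in> carrier_mat n nc"
  shows "\<exists>U \<in> carrier_mat n (vec_space.rank n A). orthonormal_cols U \<and>
           (\<forall>w \<in> set (cols A). \<exists>c \<in> carrier_vec (vec_space.rank n A). w = U *\<^sub>v c)"
proof -
  interpret cof_vec_space n "TYPE(real)" .
  let ?W = "set (cols A)"
  have W: "?W \<subseteq> carrier_vec n"
    using A cols_dim by blast
  have "lin_indpt {}"
    unfolding lin_dep_def by auto
  then obtain S where finS: "finite S" and maxS: "maximal S (\<lambda>T. T \<subseteq> ?W \<and> lin_indpt T)"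
    using maximal_exists_superset[of ?W "\<lambda>T. T \<subseteq> ?W \<and> lin_indpt T" "{}"] by auto
  have S: "S \<subseteq> ?W" "lin_indpt S"
    using maxS unfolding maximal_def by auto
  obtain ws where ws: "set ws = S" "distinct ws"
    using finite_distinct_list[OF finS] by auto
  define us where "us = gram_schmidt n ws"
  have "set ws \<subseteq> carrier_vec n" "lin_indpt (set ws)"
    using W S ws by auto
  note gs = gram_schmidt_result[OF this(1) ws(2) this(2) us_def]
  have len: "length us = rank A"
    using rank_card_indpt[OF A maxS] gs(4) ws distinct_card by fastforce
  define m where "m = rank A"
  have lenm: "length us = m" using len m_def by simp
  have us_carr: "us ! i \<in> carrier_vec n" if "i < m" for i
    using that gs(3) lenm by auto
  have orth: "us ! i \<bullet> us ! j = 0 \<longleftrightarrow> i \<noteq> j" if "i < m" "j < m" for i j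
  proof -
    have "conjugate (us ! j) = us ! j" by (rule eq_vecI) auto
    thus ?thesis using corthogonalD[OF gs(2), of i j] that lenm by simp
  qed
  define l where "l i = sqrt (us ! i \<bullet> us ! i)" for i
  have pos: "us ! i \<bullet> us ! i > 0" if "i < m" for i
  proof -
    have "us ! i \<bullet> us ! i \<ge> 0" 
      unfolding scalar_prod_def by (auto intro: sum_nonneg)
    thus ?thesis using orth[OF that that] by auto
  qed
  have l0: "l i \<noteq> 0" and ll: "l i * l i = us ! i \<bullet> us ! i" if "i < m" for i
    using pos[OF that] by (auto simp: l_def)
  define U where "U = mat n m (\<lambda>(a, i). us ! i $ a / l i)"
  have U: "U \<in> carrier_mat n m" unfolding U_def by auto
  have colU: "col U i = (1 / l i) \<cdot>\<^sub>v us ! i" if "i < m" for i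
    using that us_carr[OF that] by (auto intro!: eq_vecI simp: U_def)
  have "orthonormal_cols U"
    unfolding orthonormal_cols_def orthonormal_vecs_def
  proof (intro allI impI)
    fix i j assume "i < dim_col U" "j < dim_col U"
    hence ij: "i < m" "j < m" using U by auto
    have "col U i \<bullet> col U j = (us ! i \<bullet> us ! j) / (l i * l j)"
      using us_carr[OF ij(1)] us_carr[OF ij(2)]
      by (simp add: colU ij smult_scalar_prod_distrib[of _ n] scalar_prod_smult_distrib[of _ n])
    also have "\<dots> = (if i = j then 1 else 0)"
      using orth[OF ij] l0 ll ij pos[of i] by auto
    finally show "col U i \<bullet> col U j = (if i = j then 1 else 0)" .
  qed
  moreover have "\<exists>c \<in> carrier_vec m. w = U *\<^sub>v c" if "w \<in> ?W" for w
  proof -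
    have "w \<in> span (set us)"
      using maximal_lin_indpt_spans[OF W maxS] that ws gs(1) by auto
    then obtain a where "w = lincomb a (set us)"
      using finite_in_span[OF _ gs(3)] by auto
    hence "w = lincomb_list (\<lambda>i. a (us ! i)) us"
      using lincomb_as_lincomb_list_distinct[OF gs(3,5)] by simp
    also have "\<dots> = mat_of_cols n us *\<^sub>v vec m (\<lambda>i. a (us ! i))"
      using lincomb_list_as_mat_mult[of us] gs(3) lenm by fastforce
    also have "\<dots> = U *\<^sub>v vec m (\<lambda>i. a (us ! i) * l i)"
      using l0 lenm by (auto intro!: eq_vecI sum.cong
          simp: U_def scalar_prod_def mat_of_cols_def)
    finally show ?thesis by (rule bexI) simp
  qed
  ultimately show ?thesis using U unfolding m_def by blast
qed

section \<open>Sums of weighted outer products\<close>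

text \<open>
  A tensor in CP (canonical polyadic) form: the terms are indexed by \<open>X\<close>, the term \<open>x\<close> has weight
  \<open>w x\<close> and mode-\<open>k\<close> vector \<open>f x k\<close>. Entries are spelled out instead of using
  \<open>outer_product\<close>, so that replacing the vectors of one mode is a function update.
\<close>

definition cp_tensor ::
  "nat list \<Rightarrow> 'x set \<Rightarrow> ('x \<Rightarrow> real) \<Rightarrow> ('x \<Rightarrow> nat \<Rightarrow> real vec) \<Rightarrow> tensor" where
  "cp_tensor ns X w f =
     mk_tensor ns (\<lambda>is. \<Sum>x\<in>X. w x * (\<Prod>k<length ns. f x k $ (is ! k)))"

lemma dims_mk_tensor [simp]: "dims (mk_tensor ns f) = ns"
  by (simp add: mk_tensor_def)

lemma dims_cp_tensor [simp]: "dims (cp_tensor ns X w f) = ns"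
  by (simp add: cp_tensor_def)

lemma mk_tensor_in_carrier: "mk_tensor ns f \<in> tensor_carrier ns"
  by (simp add: mk_tensor_def tensor_carrier_def)

lemma mk_tensor_cong:
  assumes "\<And>is. is \<in> multi_indices ns \<Longrightarrow> f is = g is"
  shows "mk_tensor ns f = mk_tensor ns g"
  using assms by (auto simp: mk_tensor_def intro!: restrict_ext)

lemma cp_tensor_cong:
  assumes "\<And>x k. x \<in> X \<Longrightarrow> k < length ns \<Longrightarrow> f x k = g x k"
  shows "cp_tensor ns X w f = cp_tensor ns X w g"
  unfolding cp_tensor_def using assms
  by (intro mk_tensor_cong sum.cong refl arg_cong2[where f = "(*)"] prod.cong) auto

text \<open>
  Only the \<open>k\<close>th factor of each product depends on the contracted index \<open>i\<close>; summing over it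
  first turns \<open>\<Sum>\<^sub>i U\<^bsub>ji\<^esub> f x k $ i\<close> into an entry of \<open>U *\<^sub>v f x k\<close>.
\<close>

lemma mode_product_cp_tensor:
  assumes k: "k < length ns"
    and f: "\<And>x. x \<in> X \<Longrightarrow> f x k \<in> carrier_vec (ns ! k)"
    and U: "U \<in> carrier_mat p (ns ! k)"
  shows "mode_product (cp_tensor ns X w f) k U =
         cp_tensor (ns[k := p]) X w (\<lambda>x. (f x)(k := U *\<^sub>v f x k))"
proof -
  have row: "dim_row U = p" using U by simp
  have "(\<Sum>i<ns ! k. U $$ (is ! k, i) * entry (cp_tensor ns X w f) (is[k := i])) =
        (\<Sum>x\<in>X. w x * (\<Prod>l<length ns. ((f x)(k := U *\<^sub>v f x k)) l $ (is ! l)))"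
    if "is": "is \<in> multi_indices (ns[k := p])" for "is"
  proof -
    have len: "length is = length ns" and lt: "\<And>l. l < length ns \<Longrightarrow> is ! l < ns[k := p] ! l"
      using "is" by (auto simp: multi_indices_def)
    have isk: "is ! k < p" using lt[OF k] k by simp
    have upd: "is[k := i] \<in> multi_indices ns" if "i < ns ! k" for i
    proof -
      have "is[k := i] ! l < ns ! l" if "l < length ns" for l
        using lt[OF that] that \<open>i < ns ! k\<close> len by (cases "l = k") auto
      thus ?thesis using len by (simp add: multi_indices_def)
    qed
    have split: "(\<Prod>l<length ns. g l) = g k * (\<Prod>l\<in>{..<length ns} - {k}. g l)"
      for g :: "nat \<Rightarrow> real"
      using k by (intro prod.remove) auto
    \<comment> \<open>the part of the product that does not involve mode \<open>k\<close>\<close>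
    define R where "R x = (\<Prod>l\<in>{..<length ns} - {k}. f x l $ (is ! l))" for x
    have "(\<Sum>i<ns ! k. U $$ (is ! k, i) * entry (cp_tensor ns X w f) (is[k := i])) =
          (\<Sum>i<ns ! k. \<Sum>x\<in>X. w x * R x * (U $$ (is ! k, i) * f x k $ i))"
    proof (rule sum.cong[OF refl])
      fix i assume "i \<in> {..<ns ! k}"
      hence i: "i < ns ! k" by simp
      have "(\<Prod>l<length ns. f x l $ (is[k := i] ! l)) = f x k $ i * R x" for x
        unfolding split R_def using k len by (auto intro!: prod.cong)
      thus "U $$ (is ! k, i) * entry (cp_tensor ns X w f) (is[k := i]) =
            (\<Sum>x\<in>X. w x * R x * (U $$ (is ! k, i) * f x k $ i))"
        using upd[OF i]
        by (simp add: cp_tensor_def mk_tensor_def sum_distrib_left mult_ac)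
    qed
    also have "\<dots> = (\<Sum>x\<in>X. w x * R x * (\<Sum>i<ns ! k. U $$ (is ! k, i) * f x k $ i))"
      by (subst sum.swap) (simp add: sum_distrib_left)
    also have "\<dots> = (\<Sum>x\<in>X. w x * (\<Prod>l<length ns. ((f x)(k := U *\<^sub>v f x k)) l $ (is ! l)))"
    proof (rule sum.cong[OF refl])
      fix x assume x: "x \<in> X"
      have "(U *\<^sub>v f x k) $ (is ! k) = (\<Sum>i<ns ! k. U $$ (is ! k, i) * f x k $ i)"
        using f[OF x] U isk by (auto simp: scalar_prod_def atLeast0LessThan intro!: sum.cong)
      thus "w x * R x * (\<Sum>i<ns ! k. U $$ (is ! k, i) * f x k $ i) =
            w x * (\<Prod>l<length ns. ((f x)(k := U *\<^sub>v f x k)) l $ (is ! l))"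
        unfolding split R_def by (simp add: mult_ac)
    qed
    finally show ?thesis .
  qed
  thus ?thesis
    unfolding mode_product_def cp_tensor_def[of "ns[k := p]"]
    by (auto simp: row intro!: mk_tensor_cong)
qed

lemma tucker_product_cp_tensor:
  assumes len: "length r = length ns"
    and c: "\<And>x k. x \<in> X \<Longrightarrow> k < length ns \<Longrightarrow> c x k \<in> carrier_vec (r ! k)"
    and U: "\<And>k. k < length ns \<Longrightarrow> U k \<in> carrier_mat (ns ! k) (r ! k)"
  shows "tucker_product (cp_tensor r X w c) U = cp_tensor ns X w (\<lambda>x k. U k *\<^sub>v c x k)"
proof -
  \<comment> \<open>after \<open>m\<close> mode products, the first \<open>m\<close> modes have the final size and the others still that of the core\<close>
  have "foldl (\<lambda>T k. mode_product T k (U k)) (cp_tensor r X w c) [0..<m] =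
        cp_tensor (take m ns @ drop m r) X w (\<lambda>x k. if k < m then U k *\<^sub>v c x k else c x k)"
    if "m \<le> length ns" for m
    using that
  proof (induction m)
    case 0
    show ?case by simp
  next
    case (Suc m)
    let ?ms = "take m ns @ drop m r"
    let ?f = "\<lambda>x k. if k < m then U k *\<^sub>v c x k else c x k"
    have m: "m < length ns" using Suc.prems by simp
    have msm: "?ms ! m = r ! m" using m len by (simp add: nth_append)
    have "foldl (\<lambda>T k. mode_product T k (U k)) (cp_tensor r X w c) [0..<Suc m] =
          mode_product (cp_tensor ?ms X w ?f) m (U m)"
      using Suc by simp
    also have "\<dots> = cp_tensor (?ms[m := ns ! m]) X w (\<lambda>x. (?f x)(m := U m *\<^sub>v ?f x m))"
      using m len c U msm by (intro mode_product_cp_tensor) auto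
    also have "?ms[m := ns ! m] = take (Suc m) ns @ drop (Suc m) r"
      using m len
      by (simp add: list_update_append take_Suc_conv_app_nth Cons_nth_drop_Suc[symmetric])
    also have "(\<lambda>x. (?f x)(m := U m *\<^sub>v ?f x m)) =
               (\<lambda>x k. if k < Suc m then U k *\<^sub>v c x k else c x k)"
      by (auto simp: fun_eq_iff)
    finally show ?case .
  qed
  from this[of "length ns"] have "tucker_product (cp_tensor r X w c) U =
      cp_tensor ns X w (\<lambda>x k. if k < length ns then U k *\<^sub>v c x k else c x k)"
    using len by (simp add: tucker_product_def)
  also have "\<dots> = cp_tensor ns X w (\<lambda>x k. U k *\<^sub>v c x k)"
    by (rule cp_tensor_cong) simp
  finally show ?thesis .
qed

section \<open>Partial sums of TTr1 decompositions\<close>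

text \<open>
  For all modes but the last, the vector was produced by the decomposition at the length-\<open>k\<close> prefix
  of the leaf, which is a node of the tree; the last one has the right length by construction.
\<close>

lemma TTr1_mode_vec_carrier:
  assumes ns: "length ns \<ge> 2"
    and dec: "TTr1_decomposition ns A \<sigma> u v"
    and js: "js \<in> TTr1_leaves ns"
    and k: "k < length ns"
  shows "TTr1_mode_vec ns u v k js \<in> carrier_vec (ns ! k)"
proof (cases "k < length ns - 1")
  case True
  have len: "length js = length ns - 1" and lt: "\<And>s. s < length ns - 1 \<Longrightarrow> js ! s < TTr1_rho ns s"
    using js by (auto simp: TTr1_leaves_def TTr1_nodes_def)
  have "u (take k js @ [js ! k]) \<in> carrier_vec (ns ! k)"
  proof (cases "k = 0")
    case True
    thus ?thesis
      using dec lt[of 0] ns by (auto simp: TTr1_decomposition_def economical_svd_def)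
  next
    case False
    have "take k js \<in> TTr1_nodes ns k"
      using \<open>k < length ns - 1\<close> len lt by (auto simp: TTr1_nodes_def)
    moreover have "k \<in> {1..length ns - 2}"
      using False \<open>k < length ns - 1\<close> by auto
    ultimately show ?thesis
      using dec lt[OF \<open>k < length ns - 1\<close>]
      unfolding TTr1_decomposition_def economical_svd_def by blast
  qed
  thus ?thesis
    using True len by (simp add: TTr1_mode_vec_def take_Suc_conv_app_nth)
qed (simp add: TTr1_mode_vec_def)

text \<open>
  The index range of an outer product is read off the lengths of the vectors, so these have to
  agree with \<open>ns\<close>.
\<close>

lemma TTr1_partial_sum_eq_cp_tensor:
  assumes "\<And>js k. js \<in> I \<Longrightarrow> k < length ns \<Longrightarrow> TTr1_mode_vec ns u v k js \<in> carrier_vec (ns ! k)"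
  shows "TTr1_partial_sum ns \<sigma> u v I =
         cp_tensor ns I (TTr1_weight \<sigma>) (\<lambda>js k. TTr1_mode_vec ns u v k js)"
  unfolding TTr1_partial_sum_def cp_tensor_def
proof (intro mk_tensor_cong sum.cong refl arg_cong2[where f = "(*)"])
  fix "is" js assume "is": "is \<in> multi_indices ns" and js: "js \<in> I"
  let ?as = "map (\<lambda>k. TTr1_mode_vec ns u v k js) [0..<length ns]"
  have "map dim_vec ?as = ns"
    using assms[OF js] by (intro nth_equalityI) auto
  thus "entry (outer_product ?as) is = (\<Prod>k<length ns. TTr1_mode_vec ns u v k js $ (is ! k))"
    using "is" by (simp add: outer_product_def mk_tensor_def)
qed

theorem mainTheorem4:
  fixes ns :: "nat list" and A :: tensor
    and \<sigma> :: "nat list \<Rightarrow> real" and u :: "nat list \<Rightarrow> real vec" and v :: "nat list \<Rightarrow> tensor"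
    and I :: "nat list set" and xs :: "nat list list" and r :: "nat list"
  assumes "length ns \<ge> 2"
    and "A \<in> tensor_carrier ns"
    and "TTr1_decomposition ns A \<sigma> u v"
    and "I \<subseteq> TTr1_leaves ns" and "I \<noteq> {}"
    and "distinct xs" and "set xs = I"
    and "length r = length ns"
    and "\<And>k. k < length ns \<Longrightarrow>
           r ! k = vec_space.rank (ns ! k) (mat_of_cols (ns ! k) (map (TTr1_mode_vec ns u v k) xs))"
  shows "\<exists>S U. S \<in> tensor_carrier r \<and>
           (\<forall>k<length ns. U k \<in> carrier_mat (ns ! k) (r ! k) \<and> orthonormal_cols (U k)) \<and>
           TTr1_partial_sum ns \<sigma> u v I = tucker_product S U"
proof -
  let ?a = "\<lambda>js k. TTr1_mode_vec ns u v k js"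
  have a: "?a js k \<in> carrier_vec (ns ! k)" if "js \<in> I" "k < length ns" for js k
    using TTr1_mode_vec_carrier[OF assms(1,3)] assms(4) that by blast
  have "\<exists>U. U \<in> carrier_mat (ns ! k) (r ! k) \<and> orthonormal_cols U \<and>
          (\<forall>js\<in>I. \<exists>c \<in> carrier_vec (r ! k). ?a js k = U *\<^sub>v c)" if k: "k < length ns" for k
  proof -
    let ?M = "mat_of_cols (ns ! k) (map (TTr1_mode_vec ns u v k) xs)"
    have "set (map (TTr1_mode_vec ns u v k) xs) \<subseteq> carrier_vec (ns ! k)"
      using a k assms(7) by auto
    hence "set (cols ?M) = (\<lambda>js. ?a js k) ` I"
      using assms(7) by (simp add: cols_mat_of_cols)
    moreover have "?M \<in> carrier_mat (ns ! k) (length xs)"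
      using mat_of_cols_carrier(1)[of "ns ! k" "map (TTr1_mode_vec ns u v k) xs"] by simp
    note rank_orthonormal_factor[OF this, folded assms(9)[OF k]]
    ultimately show ?thesis
      by (simp add: Bex_def image_iff)
  qed
  then obtain U where U: "\<And>k. k < length ns \<Longrightarrow>
      U k \<in> carrier_mat (ns ! k) (r ! k) \<and> orthonormal_cols (U k) \<and>
      (\<forall>js\<in>I. \<exists>c \<in> carrier_vec (r ! k). ?a js k = U k *\<^sub>v c)"
    by metis
  have "\<forall>js k. \<exists>c. js \<in> I \<longrightarrow> k < length ns \<longrightarrow> c \<in> carrier_vec (r ! k) \<and> ?a js k = U k *\<^sub>v c"
    using U by blast
  then obtain c where c: "\<And>js k. js \<in> I \<Longrightarrow> k < length ns \<Longrightarrow>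
      c js k \<in> carrier_vec (r ! k) \<and> ?a js k = U k *\<^sub>v c js k"
    unfolding choice_iff by blast
  let ?S = "cp_tensor r I (TTr1_weight \<sigma>) c"
  have "TTr1_partial_sum ns \<sigma> u v I = cp_tensor ns I (TTr1_weight \<sigma>) ?a"
    using a by (rule TTr1_partial_sum_eq_cp_tensor)
  also have "\<dots> = cp_tensor ns I (TTr1_weight \<sigma>) (\<lambda>js k. U k *\<^sub>v c js k)"
    using c by (intro cp_tensor_cong) auto
  also have "\<dots> = tucker_product ?S U"
    using assms(8) c U by (intro tucker_product_cp_tensor[symmetric]) auto
  finally have "TTr1_partial_sum ns \<sigma> u v I = tucker_product ?S U" .
  moreover have "?S \<in> tensor_carrier r"
    unfolding cp_tensor_def by (rule mk_tensor_in_carrier)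
  ultimately show ?thesis using U by blast
qed

end
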